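(* Let $G$ be an acyclic ADT network over $\mathbb F_q$ with a single connection $c=(S,T,\mathcal X(S,T))$ of rate $R(c)=|\mathcal X(S,T)|$. The following are equivalent: (1) the connection $c$ is feasible; (2) $\mathrm{mincut}(S,T)\ge R(c)$; (3) there is an assignment of the coefficients $\alpha$, $\beta$, $\epsilon$ such that the $R(c)\times R(c)$ system matrix $M$ from $\mathcal X(S,T)$ to $\mathcal Z(T)$ is invertible over $\mathbb F_q$, i.e. $\det M\neq 0$.
   Context: ADT network model. $G=(\mathcal V,\mathcal E)$ is a directed acyclic network of supernodes. Each supernode $V$ has input ports $I(V)$ and output ports $O(V)$, and edges go from output ports to input ports of other supernodes. Linear coding over $\mathbb F_q$: - An output port $e\in O(V)$ carries $Y(e)=\sum_{e'\in I(V)}\beta_{(e',e)}Y(e')$. At the source $S$, the term $\sum_i\alpha_{(i,e)}X(S,i)$ is added, where the $X(S,i)$ are independent source processes. - An output port sends the same symbol on all of its outgoing edges. - An input port $e'$ receives $Y(e')=\sum_{(e,e')\in\mathcal E}Y(e)$, the sum taken over $\mathbb F_q$. - The destination $T$ outputs $Z(T,k)=\sum_{e'\in I(T)}\epsilon_{(e',(T,k))}Y(e')$. The coefficients $\alpha,\beta,\epsilon\in\mathbb F_q$ are free. A connection $(S,T,\mathcal X(S,T))$, with $\mathcal X(S,T)$ a set of source processes, is feasible if some coefficient choice makes $T$'s outputs $\mathcal Z(T)$ equal to $\mathcal X(S,T)$. The system matrix is $M=A(I-F)^{-1}B^T$ and satisfies $\mathcal Z(T)=\mathcal X(S,T)M$.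 Here ports are indexed $e_1,\dots,e_m$, and: - $F_{i,j}=1$ if $(e_i,e_j)\in\mathcal E$; $F_{i,j}=\beta_{(e_i,e_j)}$ if $e_i$ is an input port and $e_j$ an output port of the same supernode; $F_{i,j}=0$ otherwise. - $A_{i,j}=\alpha_{(i,e_j)}$ for $e_j\in O(S)$, and $0$ otherwise. - $B_{k,i}=\epsilon_{(e_i,(T,k))}$ for $e_i\in I(T)$, and $0$ otherwise. $\mathrm{mincut}(S,T)=\min_\Omega \mathrm{rank}(G_\Omega)$. The minimum ranges over partitions $\Omega\cup\Omega^c$ of the supernodes with $S\in\Omega$ and $T\in\Omega^c$. $G_\Omega$ is the $0$-$1$ incidence matrix of the edges from output ports of supernodes in $\Omega$ to input ports of supernodes in $\Omega^c$. *)

theory Defs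
  imports "HOL-Analysis.Analysis"
begin

text \<open>ADT network model.  Ports are the elements of a finite type 'p; supernodes are of type 'v.
  node e is the supernode owning port e, isin e says whether e is an input port
  (otherwise it is an output port).  E is the set of edges between ports.
  Source processes of the connection X(S,T) are indexed by the finite type 'r, so R(c) = CARD('r).
  The field F_q is any finite field 'a.\<close>

definition in_ports :: "('p \<Rightarrow> 'v) \<Rightarrow> ('p \<Rightarrow> bool) \<Rightarrow> 'v \<Rightarrow> 'p set" where
  "in_ports node isin V = {e. node e = V \<and> isin e}"

definition out_ports :: "('p \<Rightarrow> 'v) \<Rightarrow> ('p \<Rightarrow> bool) \<Rightarrow> 'v \<Rightarrow> 'p set" where
  "out_ports node isin V = {e. node e = V \<and> \<not> isin e}"

definition acyclic_adt_network :: "('p \<Rightarrow> 'v) \<Rightarrow> ('p \<Rightarrow> bool) \<Rightarrow> ('p \<times> 'p) set \<Rightarrow> bool" where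
  "acyclic_adt_network node isin E \<longleftrightarrow>
     (\<forall>(e, e') \<in> E. \<not> isin e \<and> isin e' \<and> node e \<noteq> node e') \<and>
     acyclic {(node e, node e') | e e'. (e, e') \<in> E}"

definition code_signals ::
  "('p \<Rightarrow> 'v) \<Rightarrow> ('p \<Rightarrow> bool) \<Rightarrow> ('p \<times> 'p) set \<Rightarrow> 'v \<Rightarrow>
   ('r::finite \<Rightarrow> 'p \<Rightarrow> 'a::field) \<Rightarrow> ('p \<Rightarrow> 'p \<Rightarrow> 'a) \<Rightarrow> ('r \<Rightarrow> 'a) \<Rightarrow> ('p::finite \<Rightarrow> 'a) \<Rightarrow> bool" where
  "code_signals node isin E S \<alpha> \<beta> x Y \<longleftrightarrow>
     (\<forall>e. \<not> isin e \<longrightarrow>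
        Y e = (\<Sum>e' \<in> in_ports node isin (node e). \<beta> e' e * Y e')
              + (if node e = S then (\<Sum>i\<in>UNIV. \<alpha> i e * x i) else 0)) \<and>
     (\<forall>e'. isin e' \<longrightarrow> Y e' = (\<Sum>e \<in> {e. (e, e') \<in> E}. Y e))"

definition dest_output ::
  "('p \<Rightarrow> 'v) \<Rightarrow> ('p \<Rightarrow> bool) \<Rightarrow> 'v \<Rightarrow> ('p \<Rightarrow> 'r \<Rightarrow> 'a::field) \<Rightarrow> ('p::finite \<Rightarrow> 'a) \<Rightarrow> 'r \<Rightarrow> 'a" where
  "dest_output node isin T \<epsilon> Y k = (\<Sum>e' \<in> in_ports node isin T. \<epsilon> e' k * Y e')"

definition feasible ::
  "('p::finite \<Rightarrow> 'v) \<Rightarrow> ('p \<Rightarrow> bool) \<Rightarrow> ('p \<times> 'p) set \<Rightarrow> 'v \<Rightarrow> 'v \<Rightarrow> 'r::finite itself \<Rightarrow> 'a::field itself \<Rightarrow> bool" where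
  "feasible node isin E S T (_ :: 'r itself) (_ :: 'a itself) \<longleftrightarrow>
     (\<exists>(\<alpha> :: 'r \<Rightarrow> 'p \<Rightarrow> 'a) \<beta> (\<epsilon> :: 'p \<Rightarrow> 'r \<Rightarrow> 'a).
        \<forall>x :: 'r \<Rightarrow> 'a.
          (\<exists>Y. code_signals node isin E S \<alpha> \<beta> x Y) \<and>
          (\<forall>Y. code_signals node isin E S \<alpha> \<beta> x Y \<longrightarrow>
                (\<forall>k. dest_output node isin T \<epsilon> Y k = x k)))"

definition A_matrix ::
  "('p::finite \<Rightarrow> 'v) \<Rightarrow> ('p \<Rightarrow> bool) \<Rightarrow> 'v \<Rightarrow> ('r::finite \<Rightarrow> 'p \<Rightarrow> 'a::field) \<Rightarrow> 'a^'p^'r" where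
  "A_matrix node isin S \<alpha> = (\<chi> i j. if j \<in> out_ports node isin S then \<alpha> i j else 0)"

definition F_matrix ::
  "('p::finite \<Rightarrow> 'v) \<Rightarrow> ('p \<Rightarrow> bool) \<Rightarrow> ('p \<times> 'p) set \<Rightarrow> ('p \<Rightarrow> 'p \<Rightarrow> 'a::field) \<Rightarrow> 'a^'p^'p" where
  "F_matrix node isin E \<beta> = (\<chi> i j.
      if (i, j) \<in> E then 1
      else if isin i \<and> \<not> isin j \<and> node i = node j then \<beta> i j
      else 0)"

definition B_matrix ::
  "('p::finite \<Rightarrow> 'v) \<Rightarrow> ('p \<Rightarrow> bool) \<Rightarrow> 'v \<Rightarrow> ('p \<Rightarrow> 'r::finite \<Rightarrow> 'a::field) \<Rightarrow> 'a^'p^'r" where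
  "B_matrix node isin T \<epsilon> = (\<chi> k i. if i \<in> in_ports node isin T then \<epsilon> i k else 0)"

definition system_matrix ::
  "('p::finite \<Rightarrow> 'v) \<Rightarrow> ('p \<Rightarrow> bool) \<Rightarrow> ('p \<times> 'p) set \<Rightarrow> 'v \<Rightarrow> 'v \<Rightarrow>
   ('r::finite \<Rightarrow> 'p \<Rightarrow> 'a::field) \<Rightarrow> ('p \<Rightarrow> 'p \<Rightarrow> 'a) \<Rightarrow> ('p \<Rightarrow> 'r \<Rightarrow> 'a) \<Rightarrow> 'a^'r^'r" where
  "system_matrix node isin E S T \<alpha> \<beta> \<epsilon> =
     A_matrix node isin S \<alpha> ** matrix_inv (mat 1 - F_matrix node isin E \<beta>)
       ** transpose (B_matrix node isin T \<epsilon> :: 'a^'p^'r)"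

text \<open>G_Omega: 0-1 incidence matrix of edges from output ports of supernodes in Omega to input
  ports of supernodes outside Omega (as a 'p x 'p matrix; the remaining rows/columns are zero,
  which does not change the rank).  The rank is taken over F_q.\<close>
definition cut_matrix ::
  "('p::finite \<Rightarrow> 'v) \<Rightarrow> ('p \<Rightarrow> bool) \<Rightarrow> ('p \<times> 'p) set \<Rightarrow> 'v set \<Rightarrow> 'a::field^'p^'p" where
  "cut_matrix node isin E \<Omega> = (\<chi> e e'.
      if (e, e') \<in> E \<and> \<not> isin e \<and> isin e' \<and> node e \<in> \<Omega> \<and> node e' \<notin> \<Omega> then 1 else 0)"

definition mincut ::
  "('p::finite \<Rightarrow> 'v) \<Rightarrow> ('p \<Rightarrow> bool) \<Rightarrow> ('p \<times> 'p) set \<Rightarrow> 'v \<Rightarrow> 'v \<Rightarrow> 'a::field itself \<Rightarrow> nat" where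
  "mincut node isin E S T (_ :: 'a itself) =
     Min {rank (cut_matrix node isin E \<Omega> :: 'a^'p^'p) | \<Omega>. S \<in> \<Omega> \<and> T \<notin> \<Omega>}"

end

theory Submission
  imports Defs
begin

text \<open>
  Feasibility is invertibility of the system matrix \<open>M\<close> because a destination can absorb the inverse of
  \<open>M\<close> into its decoding coefficients. If some cut had rank below the rate, a nonzero
  source vector would produce no signal across it and hence, by acyclicity, no output.

  For the converse, \<open>M\<close> is invertible as soon as the block matrix with rows
  \<open>[I - F, B^T]\<close> and \<open>[A, 0]\<close> is. In it the row of an input port \<open>i\<close> is the unit vector
  of \<open>i\<close> plus an arbitrary combination of unit vectors, and the row of an output port is fixed.
  Allow each row to be replaced by any one of the vectors it may be combined from. Rado's theorem
  yields a choice with linearly independent rows; its Hall condition is exactly the cut condition.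
  Since the determinant is linear in each row, a chosen vector \<open>w\<close> in row \<open>i\<close> can be traded for
  \<open>e_i + t w\<close> with a suitable \<open>t\<close> in \<open>{0, 1}\<close>. So no large field is required.
\<close>

section \<open>Rado's theorem on independent transversals\<close>

text \<open>Submodularity of the dimension of spans. \<open>P0\<close> stands in for the
  intersection because the union over \<open>K \<inter> L\<close> is only contained in the
  intersection of the two unions.\<close>

lemma (in finite_dimensional_vector_space) dim_Un_add_dim_Int_le:
  assumes "P0 \<subseteq> P" "P0 \<subseteq> Q"
  shows "dim (P \<union> Q) + dim P0 \<le> dim P + dim Q"
proof -
  have "dim {x + y |x y. x \<in> span P \<and> y \<in> span Q} + dim (span P \<inter> span Q) = dim P + dim Q"
    using dim_sums_Int[OF subspace_span[of P] subspace_span[of Q]] by simp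
  moreover have "dim P0 \<le> dim (span P \<inter> span Q)"
    using assms span_superset[of P] span_superset[of Q] by (intro dim_subset) blast
  moreover have "dim {x + y |x y. x \<in> span P \<and> y \<in> span Q} = dim (P \<union> Q)"
    by (metis span_Un dim_span)
  ultimately show ?thesis
    by linarith
qed

text \<open>The sets are thinned, keeping the rank condition, until each is a singleton. The
  condition for \<open>I\<close> itself then forces the chosen vectors to be distinct and
  independent.\<close>

theorem (in finite_dimensional_vector_space) Rado_transversal:
  assumes "finite I" "\<And>i. i \<in> I \<Longrightarrow> finite (A i)"
    and "\<And>K. K \<subseteq> I \<Longrightarrow> card K \<le> dim (\<Union>i\<in>K. A i)"
  shows "\<exists>f. (\<forall>i\<in>I. f i \<in> A i) \<and> inj_on f I \<and> independent (f ` I)"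
  using assms(2,3)
proof (induction "\<Sum>i\<in>I. card (A i)" arbitrary: A rule: less_induct)
  case less
  have ne: "A i \<noteq> {}" if "i \<in> I" for i
    using less.prems(2)[of "{i}"] that by auto
  txt \<open>If some \<open>A i\<close> contains \<open>x \<noteq> y\<close>, one of the two can be deleted: sets violating the
    condition after each deletion would uncross, by submodularity of the dimension, to a set
    violating it for \<open>A\<close> itself.\<close>
  show ?case
  proof (cases "\<exists>i\<in>I. \<exists>x\<in>A i. \<exists>y\<in>A i. x \<noteq> y")
    case True
    then obtain i x y where i: "i \<in> I" and x: "x \<in> A i" and y: "y \<in> A i" and "x \<noteq> y"
      by blast
    define B where "B z = A(i := A i - {z})" for z
    have smaller: "(\<Sum>j\<in>I. card (B z j)) < (\<Sum>j\<in>I. card (A j))" if "z \<in> A i" for z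
    proof (intro sum_strict_mono_ex1 \<open>finite I\<close> ballI)
      show "card (B z j) \<le> card (A j)" for j
        by (simp add: B_def card_Diff1_le)
      show "\<exists>j\<in>I. card (B z j) < card (A j)"
        using i card_Diff1_less[OF less.prems(1)[OF i] that] by (auto simp: B_def)
    qed
    have fin: "finite (B z j)" if "j \<in> I" for z j
      using less.prems(1)[OF that] less.prems(1)[OF i] by (simp add: B_def)
    have sub: "B z j \<subseteq> A j" for z j
      by (auto simp: B_def)
    \<comment> \<open>A violating index set must contain \<open>i\<close>, since \<open>B z\<close>
      and \<open>A\<close> agree elsewhere. Splitting \<open>i\<close> off turns the strict
      inequality into a weak one.\<close>
    have violator: "\<exists>K \<subseteq> I - {i}. dim (\<Union>(A ` K) \<union> (A i - {z})) \<le> card K"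
      if z: "z \<in> A i" and no: "\<not> (\<exists>f. (\<forall>i\<in>I. f i \<in> A i) \<and> inj_on f I \<and> independent (f ` I))" for z
    proof -
      have "\<not> (\<forall>K\<subseteq>I. card K \<le> dim (\<Union>(B z ` K)))"
        using less.hyps[OF smaller[OF z] fin] no sub by blast
      then obtain K where K: "K \<subseteq> I" "dim (\<Union>(B z ` K)) < card K"
        by (auto simp: not_le)
      have "i \<in> K"
      proof (rule ccontr)
        assume "i \<notin> K"
        then have "B z ` K = A ` K" by (intro image_cong) (auto simp: B_def)
        then show False using less.prems(2)[OF K(1)] K(2) by simp
      qed
      moreover have "(\<Union>(B z ` K)) = \<Union>(A ` (K - {i})) \<union> (A i - {z})"
        using \<open>i \<in> K\<close> by (auto simp: B_def split: if_splits)
      moreover have "card K = Suc (card (K - {i}))"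
        using card_Suc_Diff1[OF finite_subset[OF K(1) \<open>finite I\<close>] \<open>i \<in> K\<close>] by (rule sym)
      ultimately have "dim (\<Union>(A ` (K - {i})) \<union> (A i - {z})) \<le> card (K - {i})"
        using K(2) by simp
      then show ?thesis
        using K(1) by blast
    qed
    show ?thesis
    proof (rule ccontr)
      assume no: "\<not> ?thesis"
      obtain K where K: "K \<subseteq> I - {i}" "dim (\<Union>(A ` K) \<union> (A i - {x})) \<le> card K"
        using violator[OF x no] by blast
      obtain L where L: "L \<subseteq> I - {i}" "dim (\<Union>(A ` L) \<union> (A i - {y})) \<le> card L"
        using violator[OF y no] by blast
      have finKL: "finite K" "finite L"
        using K L \<open>finite I\<close> by (meson finite_Diff finite_subset)+
      \<comment> \<open>Because \<open>x \<noteq> y\<close>, the two trimmed copies of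
        \<open>A i\<close> together cover \<open>A i\<close>. Submodularity then bounds
        \<open>card K + card L + 1\<close> by \<open>card K + card L\<close>.\<close>
      have "card (K \<inter> L) \<le> dim (\<Union>(A ` (K \<inter> L)))"
        using K L by (intro less.prems(2)) auto
      moreover have "card (insert i (K \<union> L)) \<le> dim (\<Union>(A ` insert i (K \<union> L)))"
        using K L i by (intro less.prems(2)) auto
      moreover have "dim (\<Union>(A ` insert i (K \<union> L))) =
          dim ((\<Union>(A ` K) \<union> (A i - {x})) \<union> (\<Union>(A ` L) \<union> (A i - {y})))"
        using \<open>x \<noteq> y\<close> by (intro arg_cong[of _ _ dim]) auto
      moreover have "dim ((\<Union>(A ` K) \<union> (A i - {x})) \<union> (\<Union>(A ` L) \<union> (A i - {y})))
          + dim (\<Union>(A ` (K \<inter> L)))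
          \<le> dim (\<Union>(A ` K) \<union> (A i - {x})) + dim (\<Union>(A ` L) \<union> (A i - {y}))"
        by (rule dim_Un_add_dim_Int_le) auto
      moreover have "card (insert i (K \<union> L)) = Suc (card (K \<union> L))"
        using K L finKL by (subst card_insert_disjoint) auto
      moreover have "card (K \<union> L) + card (K \<inter> L) = card K + card L"
        using card_Un_Int[OF finKL] by simp
      ultimately show False
        using K(2) L(2) by linarith
    qed
  next
    case False
    define f where "f i = (SOME x. x \<in> A i)" for i
    have f: "f i \<in> A i" if "i \<in> I" for i
      using ne[OF that] by (simp add: f_def some_in_eq)
    have "A i = {f i}" if "i \<in> I" for i
      using False f[OF that] that by auto
    then have "(\<Union>i\<in>I. A i) = f ` I"
      by auto
    then have le: "card I \<le> dim (f ` I)"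
      using less.prems(2)[OF subset_refl] by simp
    have finI: "finite (f ` I)" using \<open>finite I\<close> by simp
    have "dim (f ` I) \<le> card (f ` I)"
      by (rule dim_le_card'[OF finI])
    moreover have "card (f ` I) \<le> card I"
      using card_image_le[OF \<open>finite I\<close>] .
    ultimately have "card (f ` I) = card I" "card (f ` I) \<le> dim (f ` I)"
      using le by linarith+
    then have "inj_on f I" "independent (f ` I)"
      using eq_card_imp_inj_on[OF \<open>finite I\<close>] card_le_dim_spanning[OF subset_refl span_superset finI]
      by simp_all
    then show ?thesis
      using f by blast
  qed
qed

section \<open>Independent families, determinants and rank\<close>

text \<open>Independence of a set does not see repeated vectors, so an independent family is encoded
  as injectivity together with independence of the image.\<close>

lemma (in vector_space) independent_familyI:
  assumes "finite J"
    and "\<And>c j. (\<Sum>j\<in>J. scale (c j) (v j)) = 0 \<Longrightarrow> j \<in> J \<Longrightarrow> c j = 0"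
  shows "inj_on v J" "independent (v ` J)"
proof -
  show inj: "inj_on v J"
  proof (rule inj_onI, rule ccontr)
    fix i j assume ij: "i \<in> J" "j \<in> J" "v i = v j" "i \<noteq> j"
    define c where "c k = (if k = i then 1 else if k = j then - 1 else 0 :: 'a)" for k
    have "(\<Sum>k\<in>J. scale (c k) (v k)) = (\<Sum>k\<in>{i,j}. scale (c k) (v k))"
      using ij \<open>finite J\<close> by (intro sum.mono_neutral_right) (auto simp: c_def)
    also have "\<dots> = 0"
      using ij by (simp add: c_def)
    finally have "c i = 0"
      using assms(2) ij by blast
    then show False by (simp add: c_def)
  qed
  show "independent (v ` J)"
  proof (rule independent_if_scalars_zero)
    fix f x assume "(\<Sum>x\<in>v ` J. scale (f x) x) = 0" "x \<in> v ` J"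
    then show "f x = 0"
      using assms(2)[of "f \<circ> v"] by (auto simp: sum.reindex[OF inj])
  qed (use \<open>finite J\<close> in simp)
qed

lemma (in vector_space) independent_familyD:
  assumes "finite J" "inj_on v J" "independent (v ` J)" "(\<Sum>j\<in>J. scale (c j) (v j)) = 0" "j \<in> J"
  shows "c j = 0"
proof -
  have "(\<Sum>x\<in>v ` J. scale (c (the_inv_into J v x)) x) = 0"
    using assms by (simp add: sum.reindex the_inv_into_f_f cong: sum.cong)
  then have "c (the_inv_into J v (v j)) = 0"
    using assms independentD[of "v ` J" "v ` J" "\<lambda>x. c (the_inv_into J v x)" "v j"] by blast
  then show ?thesis
    using assms by (simp add: the_inv_into_f_f)
qed

lemma det_nonzero_iff_kernel:
  fixes A :: "'a::field^'n^'n"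
  shows "det A \<noteq> 0 \<longleftrightarrow> (\<forall>x. x v* A = 0 \<longrightarrow> x = 0)"
  by (metis (no_types) det_transpose invertible_det_nz invertible_left_inverse
      matrix_left_invertible_ker transpose_matrix_vector)

text \<open>The rows \<open>u j\<close> and \<open>u j + w j\<close> give determinants that differ
  by the one with row \<open>w j\<close>, nonzero by induction, so they cannot both vanish. Taking
  \<open>t j\<close> as 0 or 1 is enough.\<close>

lemma exists_det_row_add_nonzero:
  fixes u w :: "'n::finite \<Rightarrow> 'a::field^'n"
  assumes "det (\<chi> i. w i) \<noteq> 0"
  shows "\<exists>t :: 'n \<Rightarrow> 'a. det (\<chi> i. if i \<in> J then u i + t i *s w i else w i) \<noteq> 0"
proof -
  have "finite J" by simp
  then show ?thesis
  proof induction
    case empty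
    then show ?case using assms by simp
  next
    case (insert j J)
    then obtain t :: "'n \<Rightarrow> 'a" where t: "det (\<chi> i. if i \<in> J then u i + t i *s w i else w i) \<noteq> 0"
      by blast
    let ?r = "\<lambda>s i. if i \<in> insert j J then u i + (t(j := s)) i *s w i else w i"
    let ?c = "\<lambda>i. if i \<in> J then u i + t i *s w i else w i"
    have "det (\<chi> i. ?r 1 i) = det (\<chi> i. if i = j then u j + w j else ?c i)"
      by (intro arg_cong[of _ _ det]) (auto simp: vec_eq_iff)
    also have "\<dots> = det (\<chi> i. if i = j then u j else ?c i) + det (\<chi> i. if i = j then w j else ?c i)"
      using det_row_add[of j "\<lambda>_. u j" "\<lambda>_. w j" ?c] by simp
    also have "(\<chi> i. if i = j then w j else ?c i) = (\<chi> i. ?c i)"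
      using insert.hyps by (auto simp: vec_eq_iff)
    also have "(\<chi> i. if i = j then u j else ?c i) = (\<chi> i. ?r 0 i)"
      by (auto simp: vec_eq_iff)
    finally have "det (\<chi> i. ?r 0 i) \<noteq> 0 \<or> det (\<chi> i. ?r 1 i) \<noteq> 0"
      using t by auto
    then show ?case by blast
  qed
qed

lemma sum_over_sum_type:
  fixes g :: "'p::finite + 'r::finite \<Rightarrow> 'b::comm_monoid_add"
  shows "(\<Sum>a\<in>UNIV. g a) = (\<Sum>p\<in>UNIV. g (Inl p)) + (\<Sum>r\<in>UNIV. g (Inr r))"
  using sum.Plus[of "UNIV :: 'p set" "UNIV :: 'r set" g] by (simp add: UNIV_Plus_UNIV)

lemma matrix_inv_mult:
  fixes A :: "'a::semiring_1^'n^'m"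
  assumes "invertible A"
  shows "A ** matrix_inv A = mat 1" "matrix_inv A ** A = mat 1"
  using someI_ex[OF assms[unfolded invertible_def]] by (auto simp: matrix_inv_def)

text \<open>Up to sign the product is the Schur complement of \<open>P\<close> in the block matrix.
  If \<open>x\<close> is in its left kernel and \<open>y\<close> is \<open>x\<close> times
  \<open>A\<close> times the inverse of \<open>P\<close>, then \<open>(-y, x)\<close> is in the left
  kernel of the block matrix.\<close>

lemma det_mul_nonzero_of_block:
  fixes P :: "'a::field^'p^'p" and A B :: "'a^'p^'r"
  assumes block: "det (\<chi> a b. case a of
       Inl p \<Rightarrow> (case b of Inl q \<Rightarrow> P $ p $ q | Inr k \<Rightarrow> B $ k $ p)
     | Inr r \<Rightarrow> (case b of Inl q \<Rightarrow> A $ r $ q | Inr k \<Rightarrow> 0)) \<noteq> 0" (is "det ?N \<noteq> 0")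
    and P: "invertible P"
  shows "det (A ** matrix_inv P ** transpose B) \<noteq> 0"
  unfolding det_nonzero_iff_kernel
proof (intro allI impI)
  fix x :: "'a^'r"
  assume x: "x v* (A ** matrix_inv P ** transpose B) = 0"
  define y where "y = x v* A v* matrix_inv P"
  have yP: "y v* P = x v* A"
    using P by (simp add: y_def vector_matrix_mul_assoc matrix_inv_mult matrix_mul_assoc[symmetric])
  have yB: "y v* transpose B = 0"
    using x by (simp only: y_def vector_matrix_mul_assoc)
  define z :: "'a^('p + 'r)" where "z = (\<chi> a. case a of Inl p \<Rightarrow> - (y $ p) | Inr r \<Rightarrow> x $ r)"
  have "(z v* ?N) $ b = 0" for b
  proof -
    have split: "(z v* ?N) $ b = (\<Sum>p\<in>UNIV. z $ Inl p * ?N $ Inl p $ b) + (\<Sum>r\<in>UNIV. z $ Inr r * ?N $ Inr r $ b)"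
      by (simp add: vector_matrix_mult_def sum_over_sum_type)
    show ?thesis
    proof (cases b)
      case (Inl q)
      have "(y v* P) $ q = (x v* A) $ q" using yP by simp
      then show ?thesis
        unfolding split using Inl by (simp add: z_def vector_matrix_mult_def sum_negf mult.commute)
    next
      case (Inr k)
      have "(y v* transpose B) $ k = 0" using yB by simp
      then show ?thesis
        unfolding split using Inr by (simp add: z_def vector_matrix_mult_def transpose_def sum_negf mult.commute)
    qed
  qed
  then have "z v* ?N = 0"
    by (simp add: vec_eq_iff)
  then have "z = 0"
    using block unfolding det_nonzero_iff_kernel by blast
  then have "z $ Inr r = 0" for r
    by simp
  then show "x = 0"
    by (simp add: z_def vec_eq_iff)
qed

text \<open>All rows of \<open>A ** B\<close> lie in the row span of \<open>B\<close>, whose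
  dimension is too small for them to be independent.\<close>

lemma rank_less_imp_kernel:
  fixes A :: "'a::field^'p^'r" and B :: "'a^'q^'p"
  assumes "rank B < CARD('r)"
  obtains x where "x \<noteq> 0" "x v* (A ** B) = 0"
proof -
  let ?v = "\<lambda>r. row r (A ** B)"
  have "\<not> (inj_on ?v UNIV \<and> vec.independent (range ?v))"
  proof
    assume ind: "inj_on ?v UNIV \<and> vec.independent (range ?v)"
    have row: "?v r = A $ r v* B" for r
      by (simp add: row_def vector_matrix_mult_def matrix_matrix_mult_def vec_eq_iff mult.commute)
    have "A $ r v* B \<in> vec.span (rows B)" for r
    proof -
      have "A $ r v* B = (\<Sum>p\<in>UNIV. A $ r $ p *s row p B)"
        by (simp add: vector_matrix_mult_def vec_eq_iff row_def mult.commute)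
      also have "\<dots> \<in> vec.span (rows B)"
        by (intro vec.span_sum vec.span_scale vec.span_base) (auto simp: rows_def)
      finally show ?thesis .
    qed
    then have "range ?v \<subseteq> vec.span (rows B)"
      using row by auto
    then have "card (range ?v) \<le> vec.dim (vec.span (rows B))"
      using ind by (intro vec.independent_card_le_dim) auto
    then show False
      using assms ind by (simp add: row_rank_def_gen card_image)
  qed
  then have "\<not> (\<forall>c. (\<Sum>r\<in>UNIV. c r *s ?v r) = 0 \<longrightarrow> (\<forall>j. c j = 0))"
    using vec.independent_familyI[OF finite[of UNIV], of ?v] by blast
  then obtain c j where c: "(\<Sum>r\<in>UNIV. c r *s ?v r) = 0" "c j \<noteq> 0"
    by blast
  have "(\<chi> r. c r) v* (A ** B) = 0"
    using c(1) by (simp add: vector_matrix_mult_def vec_eq_iff row_def mult.commute)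
  moreover have "(\<chi> r. c r) \<noteq> 0"
    using c(2) by (metis vec_lambda_beta zero_index)
  ultimately show ?thesis
    using that by blast
qed

text \<open>A basis of the row span is chosen among the rows and cut down to one row for each source
  process.\<close>

lemma exists_independent_rows:
  fixes C :: "'a::field^'q^'p"
  assumes "CARD('r::finite) \<le> rank C"
  shows "\<exists>\<pi> :: 'r \<Rightarrow> 'p. inj (\<lambda>r. row (\<pi> r) C) \<and> vec.independent (range (\<lambda>r. row (\<pi> r) C))"
proof -
  obtain B where B: "B \<subseteq> rows C" "vec.independent B" "card B = vec.dim (rows C)"
    by (rule vec.basis_exists[of "rows C"])
  then obtain B' where B': "B' \<subseteq> B" "card B' = CARD('r)"
    using assms obtain_subset_with_card_n[of "CARD('r)" B] unfolding row_rank_def_gen by metis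
  have "finite B'"
    using B' by (metis card_gt_0_iff zero_less_card_finite)
  then obtain b :: "'r \<Rightarrow> 'a^'q" where b: "bij_betw b UNIV B'"
    using finite_same_card_bij[of "UNIV :: 'r set" B'] B' by auto
  have "\<exists>p. b r = row p C" for r
    using bij_betwE[OF b] B B' by (auto simp: rows_def)
  then obtain \<pi> where "\<And>r. b r = row (\<pi> r) C"
    by metis
  then have "b = (\<lambda>r. row (\<pi> r) C)" by auto
  moreover have "inj b" "range b = B'"
    using b by (auto simp: bij_betw_def)
  moreover have "vec.independent B'"
    using B B' vec.independent_mono by blast
  ultimately show ?thesis
    by metis
qed

section \<open>The coding equations as a linear system\<close>

locale adt_network =
  fixes node :: "'p::finite \<Rightarrow> 'v" and isin :: "'p \<Rightarrow> bool" and E :: "('p \<times> 'p) set"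
    and S T :: 'v
  assumes acyclic_adt: "acyclic_adt_network node isin E"
    and S_neq_T: "S \<noteq> T"
begin

lemma edgeD:
  assumes "(e, e') \<in> E"
  shows "\<not> isin e" "isin e'" "node e \<noteq> node e'"
  using acyclic_adt assms by (auto simp: acyclic_adt_network_def)

lemma wf_node_edges: "wf {(node e, node e') | e e'. (e, e') \<in> E}"
proof (rule finite_acyclic_wf)
  have "{(node e, node e') | e e'. (e, e') \<in> E} = (\<lambda>(e, e'). (node e, node e')) ` E"
    by auto
  then show "finite {(node e, node e') | e e'. (e, e') \<in> E}"
    by simp
qed (use acyclic_adt in \<open>simp add: acyclic_adt_network_def\<close>)

text \<open>Induction along the acyclic order of supernodes: inputs depend on outputs of earlier
  nodes in \<open>W\<close>, outputs on inputs of the same node. \<open>W\<close> is everything when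
  \<open>I - F\<close> is inverted, and the destination side in the cut bound.\<close>

lemma signals_zero:
  fixes Y :: "'p \<Rightarrow> 'a::field"
  assumes out: "\<And>e. node e \<in> W \<Longrightarrow> \<not> isin e \<Longrightarrow> Y e = (\<Sum>e'\<in>in_ports node isin (node e). \<beta> e' e * Y e')"
    and "in": "\<And>e'. node e' \<in> W \<Longrightarrow> isin e' \<Longrightarrow> Y e' = (\<Sum>e \<in> {e. (e, e') \<in> E \<and> node e \<in> W}. Y e)"
    and "node e \<in> W"
  shows "Y e = 0"
proof -
  have "\<forall>e. node e = V \<longrightarrow> V \<in> W \<longrightarrow> Y e = 0" for V
    using wf_node_edges
  proof (induction V rule: wf_induct_rule)
    case (less V)
    have zero_in: "Y e' = 0" if "node e' = V" "V \<in> W" "isin e'" for e'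
      using less that by (subst "in") (auto intro!: sum.neutral)
    show ?case
    proof (intro allI impI)
      fix e assume "node e = V" "V \<in> W"
      then show "Y e = 0"
        using zero_in[of e] out[of e] zero_in
        by (cases "isin e") (auto simp: in_ports_def intro!: sum.neutral)
    qed
  qed
  then show ?thesis using assms(3) by blast
qed

text \<open>The coding equations say \<open>Y = Y F + x A\<close>. Edges end at input ports only, so
  each column of \<open>F\<close> holds either edge indicators or values of \<open>\<beta>\<close>,
  never both.\<close>

lemma code_signals_iff:
  fixes \<alpha> :: "'r::finite \<Rightarrow> 'p \<Rightarrow> 'a::field"
  shows "code_signals node isin E S \<alpha> \<beta> x Y \<longleftrightarrow>
    (\<chi> e. Y e) v* (mat 1 - F_matrix node isin E \<beta>) = (\<chi> i. x i) v* A_matrix node isin S \<alpha>"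
proof -
  let ?F = "F_matrix node isin E \<beta>" and ?A = "A_matrix node isin S \<alpha>"
  have YF_out: "((\<chi> e. Y e) v* ?F) $ q = (\<Sum>e'\<in>in_ports node isin (node q). \<beta> e' q * Y e')"
    if "\<not> isin q" for q
  proof -
    have "((\<chi> e. Y e) v* ?F) $ q = (\<Sum>p\<in>UNIV. if p \<in> in_ports node isin (node q) then \<beta> p q * Y p else 0)"
      using that edgeD
      by (auto simp: vector_matrix_mult_def F_matrix_def in_ports_def mult.commute intro!: sum.cong)
    then show ?thesis
      by (simp add: sum.If_cases)
  qed
  have YF_in: "((\<chi> e. Y e) v* ?F) $ q = (\<Sum>e \<in> {e. (e, q) \<in> E}. Y e)" if "isin q" for q
  proof -
    have "((\<chi> e. Y e) v* ?F) $ q = (\<Sum>p\<in>UNIV. if p \<in> {e. (e, q) \<in> E} then Y p else 0)"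
      using that by (auto simp: vector_matrix_mult_def F_matrix_def intro!: sum.cong)
    then show ?thesis
      by (simp add: sum.If_cases)
  qed
  have xA: "((\<chi> i. x i) v* ?A) $ q = (if \<not> isin q \<and> node q = S then \<Sum>i\<in>UNIV. \<alpha> i q * x i else 0)" for q
    by (auto simp: vector_matrix_mult_def A_matrix_def out_ports_def mult.commute)
  have "(\<chi> e. Y e) v* (mat 1 - ?F) = (\<chi> i. x i) v* ?A \<longleftrightarrow>
      (\<forall>q. Y q = ((\<chi> e. Y e) v* ?F) $ q + ((\<chi> i. x i) v* ?A) $ q)"
    by (simp add: vector_matrix_mult_diff_rdistrib vec_eq_iff algebra_simps)
  also have "\<dots> \<longleftrightarrow> code_signals node isin E S \<alpha> \<beta> x Y"
    unfolding code_signals_def xA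
    by (auto simp: YF_out YF_in) (metis YF_out YF_in add.right_neutral)+
  finally show ?thesis by simp
qed

lemma invertible_I_minus_F: "invertible (mat 1 - F_matrix node isin E \<beta> :: 'a::field^'p^'p)"
proof -
  have "y = 0" if "y v* (mat 1 - F_matrix node isin E \<beta>) = 0" for y :: "'a^'p"
  proof -
    \<comment> \<open>With zero source coefficients a left kernel vector is a signal assignment;
      \<open>'p\<close> merely supplies a finite index type for the sources.\<close>
    have "code_signals node isin E S (\<lambda>(i::'p) e. 0) \<beta> (\<lambda>_. 0) (($) y)"
      unfolding code_signals_iff using that by (simp add: A_matrix_def vector_matrix_mult_def vec_eq_iff)
    then have "y $ e = 0" for e
      by (intro signals_zero[where W = UNIV and \<beta> = \<beta>]) (auto simp: code_signals_def)
    then show ?thesis by (simp add: vec_eq_iff)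
  qed
  then show ?thesis
    by (simp add: invertible_det_nz det_nonzero_iff_kernel)
qed

lemma code_signals_iff_transfer:
  fixes \<alpha> :: "'r::finite \<Rightarrow> 'p \<Rightarrow> 'a::field"
  shows "code_signals node isin E S \<alpha> \<beta> x Y \<longleftrightarrow>
    (\<chi> e. Y e) = (\<chi> i. x i) v* (A_matrix node isin S \<alpha> ** matrix_inv (mat 1 - F_matrix node isin E \<beta>))"
proof -
  let ?P = "mat 1 - F_matrix node isin E \<beta>"
  have "y v* ?P v* matrix_inv ?P = y" "y v* matrix_inv ?P v* ?P = y" for y
    using matrix_inv_mult[OF invertible_I_minus_F[of \<beta>]]
    by (simp_all only: vector_matrix_mul_assoc vector_matrix_mul_rid)
  then have "y v* ?P = z \<longleftrightarrow> y = z v* matrix_inv ?P" for y z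
    by metis
  then show ?thesis
    unfolding code_signals_iff vector_matrix_mul_assoc[symmetric] by blast
qed

lemma dest_output_eq:
  "dest_output node isin T \<epsilon> Y k = ((\<chi> e. Y e) v* transpose (B_matrix node isin T \<epsilon> :: 'a::field^'p^'r::finite)) $ k"
proof -
  have "((\<chi> e. Y e) v* transpose (B_matrix node isin T \<epsilon> :: 'a^'p^'r)) $ k =
     (\<Sum>e\<in>UNIV. if e \<in> in_ports node isin T then \<epsilon> e k * Y e else 0)"
    by (auto simp: vector_matrix_mult_def transpose_def B_matrix_def mult.commute intro!: sum.cong)
  then show ?thesis
    by (simp add: sum.If_cases dest_output_def)
qed

lemma dest_output_eq_system_matrix:
  fixes \<alpha> :: "'r::finite \<Rightarrow> 'p \<Rightarrow> 'a::field"
  assumes "code_signals node isin E S \<alpha> \<beta> x Y"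
  shows "dest_output node isin T \<epsilon> Y k = ((\<chi> i. x i) v* system_matrix node isin E S T \<alpha> \<beta> \<epsilon>) $ k"
  using assms unfolding dest_output_eq code_signals_iff_transfer system_matrix_def
  by (simp only: vector_matrix_mul_assoc)

lemma code_signals_exists:
  fixes \<alpha> :: "'r::finite \<Rightarrow> 'p \<Rightarrow> 'a::field"
  shows "\<exists>Y. code_signals node isin E S \<alpha> \<beta> x Y"
  unfolding code_signals_iff_transfer by (metis vec_lambda_eta)

section \<open>Feasibility and the determinant\<close>

text \<open>Each \<open>x\<close> determines exactly one signal assignment, whose output is
  \<open>x M\<close>; correct decoding of all \<open>x\<close> therefore means
  \<open>M = 1\<close>.\<close>

lemma feasible_iff_system_matrix_eq_one:
  "feasible node isin E S T TYPE('r::finite) TYPE('a::field) \<longleftrightarrow>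
    (\<exists>(\<alpha> :: 'r \<Rightarrow> 'p \<Rightarrow> 'a) \<beta> \<epsilon>. system_matrix node isin E S T \<alpha> \<beta> \<epsilon> = mat 1)"
proof -
  have "(\<forall>x :: 'r \<Rightarrow> 'a. (\<exists>Y. code_signals node isin E S \<alpha> \<beta> x Y) \<and>
          (\<forall>Y. code_signals node isin E S \<alpha> \<beta> x Y \<longrightarrow>
                (\<forall>k. dest_output node isin T \<epsilon> Y k = x k))) \<longleftrightarrow>
        system_matrix node isin E S T \<alpha> \<beta> \<epsilon> = mat 1" (is "?L \<longleftrightarrow> ?M = mat 1") for \<alpha> \<beta> \<epsilon>
  proof -
    have "?L \<longleftrightarrow> (\<forall>x. (\<chi> i. x i) v* ?M = (\<chi> i. x i))"
      using code_signals_exists[where 'r = 'r and 'a = 'a] dest_output_eq_system_matrix[where 'r = 'r and 'a = 'a]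
      by (simp add: vec_eq_iff)
    also have "\<dots> \<longleftrightarrow> (\<forall>x. x v* ?M = x)"
      by (metis vec_lambda_eta)
    also have "\<dots> \<longleftrightarrow> (\<forall>x. transpose ?M *v x = mat 1 *v x)"
      by simp
    also have "\<dots> \<longleftrightarrow> transpose ?M = mat 1"
      by (simp add: matrix_eq)
    also have "\<dots> \<longleftrightarrow> ?M = mat 1"
      by (metis transpose_mat transpose_transpose)
    finally show ?thesis .
  qed
  then show ?thesis
    by (simp add: feasible_def)
qed

lemma feasible_iff_det_nonzero:
  "feasible node isin E S T TYPE('r::finite) TYPE('a::field) \<longleftrightarrow>
    (\<exists>(\<alpha> :: 'r \<Rightarrow> 'p \<Rightarrow> 'a) \<beta> \<epsilon>. det (system_matrix node isin E S T \<alpha> \<beta> \<epsilon>) \<noteq> 0)"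
  unfolding feasible_iff_system_matrix_eq_one
proof
  assume "\<exists>(\<alpha> :: 'r \<Rightarrow> 'p \<Rightarrow> 'a) \<beta> \<epsilon>. det (system_matrix node isin E S T \<alpha> \<beta> \<epsilon>) \<noteq> 0"
  then obtain \<alpha> :: "'r \<Rightarrow> 'p \<Rightarrow> 'a" and \<beta> \<epsilon> where "det (system_matrix node isin E S T \<alpha> \<beta> \<epsilon>) \<noteq> 0"
    by blast
  then obtain N where N: "system_matrix node isin E S T \<alpha> \<beta> \<epsilon> ** N = mat 1"
    by (meson invertible_det_nz invertible_right_inverse)
  \<comment> \<open>Decoding with \<open>\<epsilon>\<close> followed by \<open>N\<close>. As
    \<open>\<epsilon>\<close> enters \<open>M\<close> only through the last factor, this multiplies
    \<open>M\<close> by \<open>N\<close> on the right.\<close>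
  define \<epsilon>' where "\<epsilon>' e k = (\<Sum>l\<in>UNIV. \<epsilon> e l * N $ l $ k)" for e k
  have "transpose (B_matrix node isin T \<epsilon>') = transpose (B_matrix node isin T \<epsilon>) ** N"
    by (auto simp: vec_eq_iff transpose_def B_matrix_def \<epsilon>'_def matrix_matrix_mult_def)
  then have "system_matrix node isin E S T \<alpha> \<beta> \<epsilon>' = system_matrix node isin E S T \<alpha> \<beta> \<epsilon> ** N"
    by (simp add: system_matrix_def matrix_mul_assoc)
  then show "\<exists>(\<alpha> :: 'r \<Rightarrow> 'p \<Rightarrow> 'a) \<beta> \<epsilon>. system_matrix node isin E S T \<alpha> \<beta> \<epsilon> = mat 1"
    using N by metis
qed (metis det_I one_neq_zero)

section \<open>Necessity of the cut condition\<close>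

lemma card_le_rank_cut:
  fixes \<alpha> :: "'r::finite \<Rightarrow> 'p \<Rightarrow> 'a::field"
  assumes det: "det (system_matrix node isin E S T \<alpha> \<beta> \<epsilon>) \<noteq> 0" and cut: "S \<in> \<Omega>" "T \<notin> \<Omega>"
  shows "CARD('r) \<le> rank (cut_matrix node isin E \<Omega> :: 'a^'p^'p)"
proof (rule ccontr)
  let ?C = "cut_matrix node isin E \<Omega> :: 'a^'p^'p"
  let ?P = "A_matrix node isin S \<alpha> ** matrix_inv (mat 1 - F_matrix node isin E \<beta>)"
  assume "\<not> ?thesis"
  then obtain x where x: "x \<noteq> 0" "x v* (?P ** ?C) = 0"
    using rank_less_imp_kernel[of ?C ?P] by (auto simp: not_le)
  define Y where "Y = x v* ?P"
  have YC: "Y v* ?C = 0"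
    using x(2) by (simp add: Y_def vector_matrix_mul_assoc)
  have code: "code_signals node isin E S \<alpha> \<beta> (($) x) (($) Y)"
    by (simp add: code_signals_iff_transfer Y_def)
  \<comment> \<open>By \<open>YC\<close>, the contributions from \<open>\<Omega>\<close> cancel at
    every input port outside it. As \<open>S\<close> lies in \<open>\<Omega>\<close>, the signals
    outside obey closed source-free equations.\<close>
  have zero: "Y $ e = 0" if "node e \<in> - \<Omega>" for e
  proof (rule signals_zero[where W = "- \<Omega>" and \<beta> = \<beta>, OF _ _ that])
    fix e assume "node e \<in> - \<Omega>" "\<not> isin e"
    then show "Y $ e = (\<Sum>e'\<in>in_ports node isin (node e). \<beta> e' e * Y $ e')"
      using code cut by (auto simp: code_signals_def)
  next
    fix e' assume e': "node e' \<in> - \<Omega>" "isin e'"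
    have "(Y v* ?C) $ e' = (\<Sum>e\<in>UNIV. if e \<in> {e. (e, e') \<in> E \<and> node e \<in> \<Omega>} then Y $ e else 0)"
      using e' edgeD by (auto simp: vector_matrix_mult_def cut_matrix_def intro!: sum.cong)
    then have "(\<Sum>e \<in> {e. (e, e') \<in> E \<and> node e \<in> \<Omega>}. Y $ e) = 0"
      by (simp add: YC sum.If_cases)
    moreover have "Y $ e' = (\<Sum>e \<in> {e. (e, e') \<in> E \<and> node e \<in> \<Omega>} \<union> {e. (e, e') \<in> E \<and> node e \<in> - \<Omega>}. Y $ e)"
      using code e' by (auto simp: code_signals_def intro!: sum.cong)
    ultimately show "Y $ e' = (\<Sum>e \<in> {e. (e, e') \<in> E \<and> node e \<in> - \<Omega>}. Y $ e)"
      by (simp add: sum.union_disjoint disjoint_iff)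
  qed
  have "dest_output node isin T \<epsilon> (($) Y) k = 0" for k
    using zero cut by (simp add: dest_output_def in_ports_def)
  then have "x v* system_matrix node isin E S T \<alpha> \<beta> \<epsilon> = 0"
    using dest_output_eq_system_matrix[OF code] by (simp add: vec_eq_iff)
  then show False
    using det x(1) by (auto simp: det_nonzero_iff_kernel)
qed

section \<open>Sufficiency of the cut condition: row choices and transversal\<close>

text \<open>Row \<open>p\<close> of \<open>[I - F, B^T]\<close> with all \<open>\<beta>\<close> and
  \<open>\<epsilon>\<close> set to zero. For an input port it is a unit vector, since edges start at
  output ports.\<close>

definition base_row :: "'p \<Rightarrow> 'a::field^('p + 'r::finite)" where
  "base_row p = (\<chi> b. case b of
      Inl q \<Rightarrow> (if p = q then 1 else 0) - (if (p, q) \<in> E then 1 else 0)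
    | Inr k \<Rightarrow> 0)"

lemma sum_base_row:
  "(\<Sum>p\<in>UNIV. c p * (base_row p :: 'a::field^('p + 'r::finite)) $ b) =
    (case b of Inl q \<Rightarrow> c q - (\<Sum>p\<in>{p. (p, q) \<in> E}. c p) | Inr k \<Rightarrow> 0)"
  by (cases b) (simp_all add: base_row_def right_diff_distrib sum_subtractf if_distrib[of "(*) _"]
      sum.If_cases cong: if_cong)

text \<open>No edge enters an output port, so those coefficients vanish first; each input port's
  coefficient is a sum of them.\<close>

lemma sum_base_row_eq_zeroD:
  assumes "(\<Sum>p\<in>UNIV. c p *s base_row p :: 'a::field^('p + 'r::finite)) = 0"
  shows "c p = 0"
proof -
  have coord: "c q = (\<Sum>p\<in>{p. (p, q) \<in> E}. c p)" for q
    using arg_cong[OF assms, of "\<lambda>v. v $ Inl q"] by (simp add: sum_base_row)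
  have out: "c q = 0" if "\<not> isin q" for q
  proof -
    have "{p. (p, q) \<in> E} = {}" using edgeD(2) that by auto
    then show ?thesis using coord[of q] by simp
  qed
  show ?thesis
    using coord[of p] edgeD(1) out by (simp add: sum.neutral)
qed

text \<open>The unit vectors mark the columns holding free coefficients: \<open>\<beta>\<close> and,
  at \<open>T\<close>, \<open>\<epsilon>\<close> for an input port, \<open>\<alpha>\<close> for a
  source process. An output port has only its fixed row.\<close>

definition row_choices :: "'p + 'r::finite \<Rightarrow> ('a::field^('p + 'r)) set" where
  "row_choices a = (case a of
      Inl p \<Rightarrow> insert (base_row p)
        (if isin p then (\<lambda>q. axis (Inl q) 1) ` out_ports node isin (node p) \<union>
           (if node p = T then range (\<lambda>k. axis (Inr k) 1) else {}) else {})
    | Inr r \<Rightarrow> (\<lambda>q. axis (Inl q) 1) ` out_ports node isin S)"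

text \<open>The rows \<open>u\<close> completing the base rows need only come from the choices of \<open>K\<close> as a
  whole; the vector indexed by a source process need not be a choice for that process.\<close>
lemma card_le_dim_row_choices:
  fixes K :: "('p + 'r::finite) set" and u :: "'r \<Rightarrow> 'a::field^('p + 'r)"
  assumes choice: "\<And>r. Inr r \<in> K \<Longrightarrow> u r \<in> (\<Union>a\<in>K. row_choices a)"
    and indep: "\<And>c d r. (\<Sum>p\<in>UNIV. c p *s base_row p) + (\<Sum>r\<in>UNIV. d r *s u r) = 0 \<Longrightarrow>
      (\<And>p. Inl p \<notin> K \<Longrightarrow> c p = 0) \<Longrightarrow> (\<And>r. Inr r \<notin> K \<Longrightarrow> d r = 0) \<Longrightarrow> d r = 0"
  shows "card K \<le> vec.dim (\<Union>a\<in>K. row_choices a :: ('a^('p + 'r)) set)"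
proof -
  define h where "h a = (case a of Inl p \<Rightarrow> base_row p | Inr r \<Rightarrow> u r)" for a
  have "h a \<in> (\<Union>a\<in>K. row_choices a)" if "a \<in> K" for a
  proof (cases a)
    case (Inl p)
    then have "h a \<in> row_choices a"
      by (simp add: h_def row_choices_def)
    then show ?thesis using that by blast
  qed (use choice that in \<open>simp add: h_def\<close>)
  then have sub: "h ` K \<subseteq> (\<Union>a\<in>K. row_choices a)"
    by blast
  have zero: "c a = 0" if c: "(\<Sum>a\<in>K. c a *s h a) = 0" and "a \<in> K" for c a
  proof -
    \<comment> \<open>Extension by zero meets the side conditions of \<open>indep\<close>, which
      removes the source terms; a relation among base rows remains.\<close>
    define c' where "c' a = (if a \<in> K then c a else 0)" for a
    have "(\<Sum>a\<in>UNIV. c' a *s h a) = (\<Sum>a\<in>K. c a *s h a)"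
      by (intro sum.mono_neutral_cong_right) (auto simp: c'_def)
    moreover have "(\<Sum>a\<in>UNIV. c' a *s h a) =
        (\<Sum>p\<in>UNIV. c' (Inl p) *s base_row p) + (\<Sum>r\<in>UNIV. c' (Inr r) *s u r)"
      by (simp add: h_def sum_over_sum_type)
    ultimately have eq: "(\<Sum>p\<in>UNIV. c' (Inl p) *s base_row p) + (\<Sum>r\<in>UNIV. c' (Inr r) *s u r) = 0"
      using c by simp
    have r: "c' (Inr r) = 0" for r
      by (rule indep[OF eq]) (auto simp: c'_def)
    with eq have "(\<Sum>p\<in>UNIV. c' (Inl p) *s base_row p :: 'a^('p + 'r)) = 0"
      by simp
    then have "c' (Inl p) = 0" for p
      by (rule sum_base_row_eq_zeroD)
    with r have "c' a = 0"
      by (cases a) auto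
    then show ?thesis
      using \<open>a \<in> K\<close> by (simp add: c'_def)
  qed
  have "inj_on h K" "vec.independent (h ` K)"
    using vec.independent_familyI[OF finite[of K], where v = h] zero by blast+
  then show ?thesis
    using vec.independent_card_le_dim[OF sub] by (simp add: card_image)
qed

lemma Hall_row_choices:
  fixes K :: "('p + 'r::finite) set"
  assumes cut: "\<And>\<Omega>. S \<in> \<Omega> \<Longrightarrow> T \<notin> \<Omega> \<Longrightarrow> CARD('r) \<le> rank (cut_matrix node isin E \<Omega> :: 'a::field^'p^'p)"
  shows "card K \<le> vec.dim (\<Union>a\<in>K. row_choices a :: ('a^('p + 'r)) set)"
proof (cases "(\<exists>r. Inr r \<in> K) \<and> (\<forall>p. Inl p \<in> K \<longrightarrow> isin p \<longrightarrow> node p \<noteq> T)")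
  case False
  \<comment> \<open>If \<open>K\<close> has a source row, it also has an input port of
    \<open>T\<close>, which offers all unit vectors at \<open>Inr\<close>. Base rows vanish in those
    columns.\<close>
  show ?thesis
  proof (rule card_le_dim_row_choices)
    fix r assume "Inr r \<in> K"
    with False obtain p where "Inl p \<in> K" "isin p" "node p = T"
      by blast
    then show "axis (Inr r) 1 \<in> (\<Union>a\<in>K. row_choices a)"
      by (intro UN_I[of "Inl p"]) (auto simp: row_choices_def)
  next
    fix c d r
    assume "(\<Sum>p\<in>UNIV. c p *s base_row p) + (\<Sum>r\<in>UNIV. d r *s axis (Inr r) 1) = (0 :: 'a^('p + 'r))"
    from arg_cong[OF this, of "\<lambda>v. v $ Inr r"] show "d r = 0"
      by (simp add: sum_base_row axis_def if_distrib[of "(*) _"] cong: if_cong)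
  qed
next
  case True
  txt \<open>The source and the nodes with an input port in \<open>K\<close> form one side of a cut; output ports with
    independent cut rows supply the vectors for the source processes.\<close>
  define \<Omega> where "\<Omega> = insert S {node p | p. Inl p \<in> K \<and> isin p}"
  let ?C = "cut_matrix node isin E \<Omega> :: 'a^'p^'p"
  have "CARD('r) \<le> rank ?C"
    using True S_neq_T by (intro cut) (auto simp: \<Omega>_def)
  from exists_independent_rows[OF this] obtain \<pi> :: "'r \<Rightarrow> 'p"
    where \<pi>: "inj (\<lambda>r. row (\<pi> r) ?C)" "vec.independent (range (\<lambda>r. row (\<pi> r) ?C))"
    by blast
  \<comment> \<open>Independent rows are nonzero, so an edge leaves \<open>\<Omega>\<close> from
    each \<open>\<pi> r\<close>.\<close>
  have \<pi>_out: "\<not> isin (\<pi> r)" "node (\<pi> r) \<in> \<Omega>" for r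
  proof -
    have "row (\<pi> r) ?C \<noteq> 0"
      using \<pi>(2) vec.dependent_zero by (metis rangeI)
    then show "\<not> isin (\<pi> r)" "node (\<pi> r) \<in> \<Omega>"
      by (auto simp: vec_eq_iff row_def cut_matrix_def split: if_splits)
  qed
  show ?thesis
  proof (rule card_le_dim_row_choices)
    fix r
    have "\<exists>a\<in>K. axis (Inl (\<pi> r)) 1 \<in> (row_choices a :: ('a^('p + 'r)) set)"
    proof (cases "node (\<pi> r) = S")
      case S: True
      obtain s where "Inr s \<in> K" using True by blast
      then show ?thesis
        using S \<pi>_out[of r] by (intro bexI[of _ "Inr s"]) (auto simp: row_choices_def out_ports_def)
    next
      case False
      then obtain p where "Inl p \<in> K" "isin p" "node p = node (\<pi> r)"
        using \<pi>_out[of r] by (auto simp: \<Omega>_def)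
      then show ?thesis
        using \<pi>_out[of r] by (intro bexI[of _ "Inl p"]) (auto simp: row_choices_def out_ports_def)
    qed
    then show "axis (Inl (\<pi> r)) 1 \<in> (\<Union>a\<in>K. row_choices a :: ('a^('p + 'r)) set)"
      by blast
  next
    fix c d r
    assume eq: "(\<Sum>p\<in>UNIV. c p *s base_row p) + (\<Sum>r\<in>UNIV. d r *s axis (Inl (\<pi> r)) 1) = (0 :: 'a^('p + 'r))"
      and c: "\<And>p. Inl p \<notin> K \<Longrightarrow> c p = 0"
    \<comment> \<open>The relation is read by column. Output ports express \<open>c\<close> through
      \<open>d\<close>; an input port outside \<open>\<Omega>\<close> is not in \<open>K\<close>, so
      its \<open>c\<close> is zero and its column becomes a relation among the cut rows with
      coefficients \<open>d\<close>.\<close>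
    have coord: "c q - (\<Sum>p\<in>{p. (p, q) \<in> E}. c p) + (\<Sum>r\<in>UNIV. if \<pi> r = q then d r else 0) = 0" for q
    proof -
      have "(\<Sum>r\<in>UNIV. d r *s axis (Inl (\<pi> r)) 1 :: 'a^('p + 'r)) $ Inl q =
          (\<Sum>r\<in>UNIV. if \<pi> r = q then d r else 0)"
        by (auto simp: axis_def intro!: sum.cong)
      then show ?thesis
        using arg_cong[OF eq, of "\<lambda>v. v $ Inl q"] by (simp add: sum_base_row)
    qed
    have out: "c q = - (\<Sum>r\<in>UNIV. if \<pi> r = q then d r else 0)" if "\<not> isin q" for q
    proof -
      have "{p. (p, q) \<in> E} = {}" using edgeD(2) that by auto
      then show ?thesis using coord[of q] by (simp add: eq_neg_iff_add_eq_0)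
    qed
    have "(\<Sum>r\<in>UNIV. d r *s row (\<pi> r) ?C) $ q = 0" for q
    proof (cases "isin q \<and> node q \<notin> \<Omega>")
      case True
      then have "Inl q \<notin> K" by (auto simp: \<Omega>_def)
      have "\<pi> r \<noteq> q" for r
        using True \<pi>_out by blast
      then have "0 = (\<Sum>p\<in>{p. (p, q) \<in> E}. c p)"
        using coord[of q] c[OF \<open>Inl q \<notin> K\<close>] by simp
      also have "\<dots> = (\<Sum>p\<in>{p. (p, q) \<in> E}. - (\<Sum>r\<in>UNIV. if \<pi> r = p then d r else 0))"
        using out edgeD(1) by (intro sum.cong) auto
      also have "\<dots> = - (\<Sum>r\<in>UNIV. \<Sum>p\<in>{p. (p, q) \<in> E}. if \<pi> r = p then d r else 0)"
        by (simp only: sum_negf) (subst sum.swap, rule refl)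
      also have "\<dots> = - (\<Sum>r\<in>UNIV. if (\<pi> r, q) \<in> E then d r else 0)"
        by simp
      finally show ?thesis
        using True \<pi>_out by (simp add: row_def cut_matrix_def if_distrib[of "(*) _"] cong: if_cong)
    qed (auto simp: row_def cut_matrix_def)
    then have "(\<Sum>r\<in>UNIV. d r *s row (\<pi> r) ?C) = 0"
      by (simp add: vec_eq_iff)
    then show "d r = 0"
      using vec.independent_familyD[OF finite \<pi>] by blast
  qed
qed

lemma exists_det_nonzero:
  assumes cut: "\<And>\<Omega>. S \<in> \<Omega> \<Longrightarrow> T \<notin> \<Omega> \<Longrightarrow> CARD('r::finite) \<le> rank (cut_matrix node isin E \<Omega> :: 'a::field^'p^'p)"
  shows "\<exists>(\<alpha> :: 'r \<Rightarrow> 'p \<Rightarrow> 'a) \<beta> \<epsilon>. det (system_matrix node isin E S T \<alpha> \<beta> \<epsilon>) \<noteq> 0"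
proof -
  have "finite (row_choices a :: ('a^('p + 'r)) set)" for a
    by (simp add: row_choices_def split: sum.splits)
  then obtain f :: "'p + 'r \<Rightarrow> 'a^('p + 'r)"
    where f: "\<And>a. f a \<in> row_choices a" and ind: "inj f" "vec.independent (range f)"
    using vec.Rado_transversal[OF finite[of UNIV], of row_choices] Hall_row_choices[OF cut] by auto
  have "det (\<chi> a. f a) \<noteq> 0"
    unfolding det_nonzero_iff_kernel
  proof (intro allI impI)
    fix x assume "x v* (\<chi> a. f a) = 0"
    then have "(\<Sum>a\<in>UNIV. x $ a *s f a) = 0"
      by (simp add: vector_matrix_mult_def vec_eq_iff mult.commute)
    then have "x $ a = 0" for a
      using vec.independent_familyD[OF finite ind, of "($) x" a] by simp
    then show "x = 0"
      by (simp add: vec_eq_iff)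
  qed
  \<comment> \<open>Only input-port rows that left their base row are changed. Adding the unit
    vector restores the diagonal entry that \<open>I - F\<close> must have.\<close>
  from exists_det_row_add_nonzero[OF this, of "{Inl p | p. isin p \<and> f (Inl p) \<noteq> base_row p}" "\<lambda>a. axis a 1"]
  obtain t where t: "det (\<chi> a. if a \<in> {Inl p | p. isin p \<and> f (Inl p) \<noteq> base_row p}
      then axis a 1 + t a *s f a else f a) \<noteq> 0" (is "det ?N \<noteq> 0")
    by blast
  \<comment> \<open>Read off from the rows of \<open>?N\<close>. \<open>\<beta>\<close> carries a
    minus sign because \<open>F\<close> enters as \<open>I - F\<close>, whereas
    \<open>\<epsilon>\<close> enters \<open>B^T\<close> unchanged.\<close>
  define \<alpha> where "\<alpha> r q = (if f (Inr r) = axis (Inl q) 1 then 1 else 0 :: 'a)" for r q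
  define \<beta> where "\<beta> p q = (if f (Inl p) = axis (Inl q) 1 then - t (Inl p) else 0)" for p q
  define \<epsilon> where "\<epsilon> p k = (if f (Inl p) = axis (Inr k) 1 then t (Inl p) else 0)" for p and k :: 'r
  let ?P = "mat 1 - F_matrix node isin E \<beta>"
  have base_axis: "base_row p = (axis (Inl p) 1 :: 'a^('p + 'r))" if "isin p" for p
    using that edgeD(1) by (auto simp: vec_eq_iff base_row_def axis_def split: sum.splits)
  have axis_nth: "axis i (1 :: 'a) $ j = (if i = j then 1 else 0)" for i j :: "'p + 'r"
    by (simp add: axis_def)
  have "?N $ a $ b = (case a of
       Inl p \<Rightarrow> (case b of Inl q \<Rightarrow> ?P $ p $ q | Inr k \<Rightarrow> B_matrix node isin T \<epsilon> $ k $ p)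
     | Inr r \<Rightarrow> (case b of Inl q \<Rightarrow> A_matrix node isin S \<alpha> $ r $ q | Inr k \<Rightarrow> 0))" for a b
  proof (cases a)
    case (Inr r)
    then obtain q where "f a = axis (Inl q) 1" "q \<in> out_ports node isin S"
      using f[of a] by (auto simp: row_choices_def)
    then show ?thesis
      using Inr by (auto simp: A_matrix_def \<alpha>_def axis_eq_axis axis_nth split: sum.splits)
  next
    case (Inl p)
    consider (out) "\<not> isin p" "f a = base_row p" | (keep) "isin p" "f a = axis (Inl p) 1"
      | (fwd) q where "isin p" "f a = axis (Inl q) 1" "\<not> isin q" "node q = node p"
      | (dest) k where "isin p" "f a = axis (Inr k) 1" "node p = T"
      using f[of a] Inl base_axis
      by (cases "isin p") (auto simp: row_choices_def out_ports_def split: if_splits)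
    then show ?thesis
    proof cases
      case out
      then show ?thesis
        using Inl by (auto simp: base_row_def F_matrix_def mat_def B_matrix_def in_ports_def split: sum.splits)
    next
      case keep
      then show ?thesis
        using Inl edgeD base_axis[OF keep(1)]
        by (auto simp: F_matrix_def mat_def B_matrix_def \<beta>_def \<epsilon>_def axis_eq_axis axis_nth split: sum.splits)
    next
      case fwd
      then show ?thesis
        using Inl edgeD base_axis[OF fwd(1)]
        by (auto simp: F_matrix_def mat_def B_matrix_def \<beta>_def \<epsilon>_def axis_eq_axis axis_nth split: sum.splits)
    next
      case dest
      then show ?thesis
        using Inl edgeD base_axis[OF dest(1)]
        by (auto simp: F_matrix_def mat_def B_matrix_def in_ports_def \<beta>_def \<epsilon>_def axis_eq_axis axis_nth split: sum.splits)
    qed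
  qed
  then have "?N = (\<chi> a b. case a of
       Inl p \<Rightarrow> (case b of Inl q \<Rightarrow> ?P $ p $ q | Inr k \<Rightarrow> B_matrix node isin T \<epsilon> $ k $ p)
     | Inr r \<Rightarrow> (case b of Inl q \<Rightarrow> A_matrix node isin S \<alpha> $ r $ q | Inr k \<Rightarrow> 0))"
    by (simp add: vec_eq_iff)
  then have "det (system_matrix node isin E S T \<alpha> \<beta> \<epsilon>) \<noteq> 0"
    unfolding system_matrix_def
    using t invertible_I_minus_F by (intro det_mul_nonzero_of_block) simp_all
  then show ?thesis
    by blast
qed

section \<open>Minimum cut and conclusion\<close>

lemma le_mincut_iff:
  "n \<le> mincut node isin E S T TYPE('a::field) \<longleftrightarrow>
    (\<forall>\<Omega>. S \<in> \<Omega> \<longrightarrow> T \<notin> \<Omega> \<longrightarrow> n \<le> rank (cut_matrix node isin E \<Omega> :: 'a^'p^'p))"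
proof -
  let ?R = "{rank (cut_matrix node isin E \<Omega> :: 'a^'p^'p) | \<Omega>. S \<in> \<Omega> \<and> T \<notin> \<Omega>}"
  \<comment> \<open>There may be infinitely many supernodes and cuts; the minimum is over a finite
    set because ranks are bounded by the number of ports.\<close>
  have "rank C \<le> CARD('p)" for C :: "'a^'p^'p"
    using vec.dim_subset[OF subset_UNIV, of "rows C"] by (simp only: row_rank_def_gen vec_dim_card)
  then have "finite ?R"
    by (intro finite_subset[of ?R "{..CARD('p)}"]) auto
  moreover have "?R \<noteq> {}"
    using S_neq_T by auto
  ultimately show ?thesis
    unfolding mincut_def by (subst Min_ge_iff) auto
qed

end

theorem theorem3:
  fixes node :: "'p::finite \<Rightarrow> 'v" and isin :: "'p \<Rightarrow> bool" and E :: "('p \<times> 'p) set"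
    and S T :: 'v
  assumes "acyclic_adt_network node isin E"
    and "S \<noteq> T"
  shows "(feasible node isin E S T TYPE('r::finite) TYPE('a::{field,finite})
            \<longleftrightarrow> mincut node isin E S T TYPE('a) \<ge> CARD('r))
       \<and> (mincut node isin E S T TYPE('a) \<ge> CARD('r)
            \<longleftrightarrow> (\<exists>(\<alpha> :: 'r \<Rightarrow> 'p \<Rightarrow> 'a) \<beta> (\<epsilon> :: 'p \<Rightarrow> 'r \<Rightarrow> 'a).
                   det (system_matrix node isin E S T \<alpha> \<beta> \<epsilon>) \<noteq> 0))"
proof -
  interpret adt_network node isin E S T
    using assms by unfold_locales
  have "CARD('r) \<le> mincut node isin E S T TYPE('a) \<longleftrightarrow>
      (\<exists>(\<alpha> :: 'r \<Rightarrow> 'p \<Rightarrow> 'a) \<beta> (\<epsilon> :: 'p \<Rightarrow> 'r \<Rightarrow> 'a).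
        det (system_matrix node isin E S T \<alpha> \<beta> \<epsilon>) \<noteq> 0)"
    unfolding le_mincut_iff using exists_det_nonzero card_le_rank_cut by blast
  then show ?thesis
    using feasible_iff_det_nonzero[where 'r = 'r and 'a = 'a] by blast
qed

end
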